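(* For $x\in\mathbb R^+$ and $t\ge0$, the transition density $h(x,t)=\frac{\partial}{\partial x}P(\mathcal Z(t)\le x\mid\mathcal Z(0)=0)=\sum_{j=1}^df(x,j,t)$ satisfies the partial differential equation $$\frac{\partial}{\partial t}h(x,t)=-\xi h(x,t)-\frac{\partial}{\partial x}\Big\{-\alpha(x-\beta)h(x,t)\Big\}+\frac12\sigma^2\frac{\partial^2}{\partial x^2}h(x,t),$$ with the conditions $$-\xi+\alpha\beta h(0,t)-\frac{\sigma^2}{2}\frac{\partial}{\partial x}h(x,t)\Big|_{x=0}=0,\qquad\lim_{x\to+\infty}h(x,t)=0,$$ and the Dirac-delta initial condition $\lim_{t\to0^+}h(x,t)=\delta(x)$.
   Context: Let $d$ be a positive integer, $D=\{1,\dots,d\}$, $l_0\in D$, $\alpha,\gamma,\nu,\xi>0$, $\sigma^2=\alpha\nu$, $\beta=\gamma\nu/\alpha$, and let $\mathbf C=(c_{l,j})_{l,j\in D}$ be an irreducible stochastic matrix. $\mathcal X=(\mathcal Z(t),J(t))$, $t\ge0$, is the process on the star graph $\{0\}\cup(\mathbb R^+\times D)$ ($d$ half-lines joined at the origin), started at $0$, whose density $f(x,j,t)$ at state $x$ of ray $j$ at time $t$ satisfies: $$\frac{\partial}{\partial t}f(x,j,t)=-\frac{\partial}{\partial x}\Big\{[-\alpha(x-\beta)]f(x,j,t)\Big\}+\frac12\sigma^2\frac{\partial^2}{\partial x^2}f(x,j,t)-\xi f(x,j,t),$$ $f(x,j,0)=\delta(x)\delta_{j,l_0}$, $$\sum_{l\in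 D}\left\{\alpha\beta f(0,l,t)-\frac{\sigma^2}{2}\frac{\partial}{\partial x}f(x,l,t)\Big|_{x=0}\right\}-\xi=0,$$ $f(0,j,t)=\sum_{l\in D}c_{l,j}f(0,l,t)$ and $\lim_{x\to+\infty}f(x,j,t)=0$ for all $j\in D$. (It is the diffusion limit, as $\epsilon\to0^+$, $N\to\infty$, $N\epsilon\to\infty$, $N\epsilon^2\to\nu$, of $(\epsilon\,\mathcal N(t),J(t))$, where $(\mathcal N(t),J(t))$ is the continuous-time Markov chain on $\{0,\dots,N\}\times D$ started at $(0,l_0)$ with rates $(0,l)\to(1,j)$: $c_{l,j}\lambda N$; $(k,j)\to(k+1,j)$: $\lambda(N-k)$ for $1\le k\le N-1$; $(k,j)\to(k-1,j)$: $\mu(N+k)$ and additionally $(k,j)\to(0,j)$: $\xi$ for $1\le k\le N$; with $\lambda=\frac\alpha2+\frac\gamma2\epsilon$, $\mu=\frac\alpha2-\frac\gamma2\epsilon$.) *)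

theory Defs
  imports "HOL-Probability.Probability"
begin

text \<open>Matrices over the index set \<open>{1..d}\<close> are functions \<open>nat \<Rightarrow> nat \<Rightarrow> real\<close>.\<close>

definition stochastic_matrix :: "nat \<Rightarrow> (nat \<Rightarrow> nat \<Rightarrow> real) \<Rightarrow> bool" where
  "stochastic_matrix d C \<longleftrightarrow>
     (\<forall>l\<in>{1..d}. \<forall>j\<in>{1..d}. 0 \<le> C l j) \<and> (\<forall>l\<in>{1..d}. (\<Sum>j\<in>{1..d}. C l j) = 1)"

primrec matrix_pow :: "nat \<Rightarrow> (nat \<Rightarrow> nat \<Rightarrow> real) \<Rightarrow> nat \<Rightarrow> nat \<Rightarrow> nat \<Rightarrow> real" where
  "matrix_pow d C 0 = (\<lambda>l j. if l = j then 1 else 0)"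
| "matrix_pow d C (Suc n) = (\<lambda>l j. \<Sum>k\<in>{1..d}. C l k * matrix_pow d C n k j)"

definition irreducible_matrix :: "nat \<Rightarrow> (nat \<Rightarrow> nat \<Rightarrow> real) \<Rightarrow> bool" where
  "irreducible_matrix d C \<longleftrightarrow>
     (\<forall>l\<in>{1..d}. \<forall>j\<in>{1..d}. \<exists>n. 0 < matrix_pow d C n l j)"

text \<open>
  States of the star graph are pairs \<open>(x, j)\<close> with \<open>x \<ge> 0\<close> and \<open>j \<in> {1..d}\<close>, all the pairs
  \<open>(0, j)\<close> representing the single vertex \<open>0\<close>. The reference measure gives mass zero to the
  vertex, so the redundancy does not affect densities.
\<close>

definition star_measure :: "nat \<Rightarrow> (real \<times> nat) measure" where
  "star_measure d = restrict_space lborel {0..} \<Otimes>\<^sub>M count_space {1..d}"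

text \<open>
  Bounded continuous functions on the star graph, as one function per ray. Continuity at the
  vertex amounts to continuity along each ray and agreement at \<open>0\<close>.
\<close>

definition star_test_function :: "nat \<Rightarrow> (real \<Rightarrow> nat \<Rightarrow> real) \<Rightarrow> bool" where
  "star_test_function d \<phi> \<longleftrightarrow>
     (\<forall>j\<in>{1..d}. continuous_on {0..} (\<lambda>x. \<phi> x j) \<and> bounded ((\<lambda>x. \<phi> x j) ` {0..})) \<and>
     (\<forall>j\<in>{1..d}. \<forall>k\<in>{1..d}. \<phi> 0 j = \<phi> 0 k)"

text \<open>
  The Dirac initial condition \<open>f(x,j,0) = \<delta>(x) \<delta>\<^sub>j\<^sub>,\<^sub>l\<^sub>0\<close> for a density on the star graph, as a weak
  limit: its pairing with \<open>\<phi>\<close> is \<open>\<Sum>\<^sub>j \<phi>(0,j) \<delta>\<^sub>j\<^sub>,\<^sub>l\<^sub>0 = \<phi>(0,l\<^sub>0)\<close>. Test functions must be single-valued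
  at the vertex: weak convergence on each ray separately would be incompatible, for \<open>d > 1\<close>, with
  \<open>f(0,j,t) = \<Sum>\<^sub>l c\<^sub>l\<^sub>,\<^sub>j f(0,l,t)\<close>, since that condition spreads the mass leaving the vertex
  over all rays immediately.
\<close>

definition star_dirac_initial :: "nat \<Rightarrow> nat \<Rightarrow> (real \<Rightarrow> nat \<Rightarrow> real \<Rightarrow> real) \<Rightarrow> bool" where
  "star_dirac_initial d l0 f \<longleftrightarrow>
     (\<forall>\<phi>. star_test_function d \<phi> \<longrightarrow>
        ((\<lambda>t. \<Sum>j\<in>{1..d}. LINT x:{0..}|lborel. \<phi> x j * f x j t)
           \<longlongrightarrow> (\<Sum>j\<in>{1..d}. \<phi> 0 j * (if j = l0 then 1 else 0))) (at_right 0))"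

text \<open>On the half-line \<open>[0,\<infinity>)\<close>, \<open>\<delta>\<close> carries its full unit mass at the endpoint \<open>0\<close>.\<close>

definition dirac_initial :: "(real \<Rightarrow> real \<Rightarrow> real) \<Rightarrow> bool" where
  "dirac_initial u \<longleftrightarrow>
     (\<forall>\<phi>. continuous_on {0..} \<phi> \<and> bounded (\<phi> ` {0..}) \<longrightarrow>
        ((\<lambda>t. LINT x:{0..}|lborel. \<phi> x * u x t) \<longlongrightarrow> \<phi> 0) (at_right 0))"

text \<open>
  Existence of the derivatives in the equation, needed because \<^const>\<open>deriv\<close> is total; at the
  endpoint the derivative is one-sided.
\<close>

definition FP_regular :: "(real \<Rightarrow> real \<Rightarrow> real) \<Rightarrow> bool" where
  "FP_regular u \<longleftrightarrow>
     (\<forall>t>0. \<forall>x>0.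
        (\<lambda>s. u x s) field_differentiable (at t) \<and>
        (\<lambda>y. u y t) field_differentiable (at x) \<and>
        deriv (\<lambda>y. u y t) field_differentiable (at x)) \<and>
     (\<forall>t>0. (\<lambda>y. u y t) field_differentiable (at 0 within {0..}))"

definition boundary_deriv :: "(real \<Rightarrow> real) \<Rightarrow> real" where
  "boundary_deriv g = vector_derivative g (at 0 within {0..})"

text \<open>The derivative of the distribution function is one-sided at \<open>x = 0\<close> and two-sided for
  \<open>x > 0\<close>.\<close>

definition transition_density ::
    "'a measure \<Rightarrow> (real \<Rightarrow> 'a \<Rightarrow> real) \<Rightarrow> real \<Rightarrow> real \<Rightarrow> real" where
  "transition_density M Z x t =
     vector_derivative (\<lambda>y. \<P>(\<omega> in M. Z t \<omega> \<le> y \<bar> Z 0 \<omega> = 0)) (at x within {0..})"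

end

theory Submission
  imports Defs
begin

text \<open>
  Since \<open>Z 0 = 0\<close> almost surely, conditioning is vacuous, and by Tonelli \<open>Z t\<close> has the density
  \<open>\<Sum>\<^sub>j f(x,j,t)\<close> on the half-line. This sum is continuous up to \<open>x = 0\<close>, so the derivative of the
  distribution function equals it at every point, not only almost everywhere. As the equation is
  linear with coefficients independent of \<open>j\<close>, everything else follows by summing over the rays; for
  the initial condition, a test function on the half-line is lifted to the star graph by ignoring \<open>j\<close>.
\<close>

section \<open>The law of the distance coordinate of a random point of the star graph\<close>

lemma marginal_of_star_density:
  fixes f :: "real \<Rightarrow> nat \<Rightarrow> real"
  assumes dens: "distributed M (star_measure d) (\<lambda>\<omega>. (X \<omega>, K \<omega>)) (\<lambda>(x, j). ennreal (f x j))"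
    and nonneg: "\<And>x j. 0 \<le> x \<Longrightarrow> j \<in> {1..d} \<Longrightarrow> 0 \<le> f x j"
    and A: "A \<in> sets borel"
  shows "emeasure M {\<omega> \<in> space M. X \<omega> \<in> A}
    = (\<integral>\<^sup>+ x\<in>{0..} \<inter> A. ennreal (\<Sum>j\<in>{1..d}. f x j) \<partial>lborel)"
proof -
  let ?R = "restrict_space lborel {0::real..}" and ?N = "count_space {1..d}"
  let ?F = "\<lambda>(x, j). ennreal (f x j)"
  \<comment> \<open>Tonelli, in the form \<open>nn_integral_fst\<close>, asks for sigma-finiteness
    of the inner factor, the counting measure on the finite set of rays.\<close>
  interpret N: sigma_finite_measure ?N
    by (rule sigma_finite_measure_count_space_finite) simp
  have F [measurable]: "?F \<in> borel_measurable (?R \<Otimes>\<^sub>M ?N)"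
    using distributed_borel_measurable[OF dens] by (simp add: star_measure_def)
  have X: "(\<lambda>\<omega>. (X \<omega>, K \<omega>)) \<in> measurable M (star_measure d)"
    using distributed_measurable[OF dens] .
  have fst_meas [measurable]: "fst \<in> measurable (?R \<Otimes>\<^sub>M ?N) borel"
    by (rule measurable_compose[OF measurable_fst])
       (simp add: measurable_restrict_space1)
  define B where "B = fst -` A \<inter> space (?R \<Otimes>\<^sub>M ?N)"
  have B [measurable]: "B \<in> sets (?R \<Otimes>\<^sub>M ?N)"
    unfolding B_def using A fst_meas by (rule measurable_sets[rotated])
  \<comment> \<open>The cylinder \<open>B\<close> is cut down to the space of the product. No
    outcome is lost, since the pair \<open>(X, K)\<close> is measurable and so takes all its values
    there.\<close>
  have "{\<omega> \<in> space M. X \<omega> \<in> A} = (\<lambda>\<omega>. (X \<omega>, K \<omega>)) -` B \<inter> space M"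
    using measurable_space[OF X] by (auto simp: B_def star_measure_def)
  then have "emeasure M {\<omega> \<in> space M. X \<omega> \<in> A} = (\<integral>\<^sup>+ z. ?F z * indicator B z \<partial>(?R \<Otimes>\<^sub>M ?N))"
    using distributed_emeasure[OF dens, of B] B unfolding star_measure_def by simp
  also have "\<dots> = (\<integral>\<^sup>+ x. \<integral>\<^sup>+ j. ?F (x, j) * indicator B (x, j) \<partial>?N \<partial>?R)"
    by (rule N.nn_integral_fst[symmetric]) measurable
  also have "\<dots> = (\<integral>\<^sup>+ x. ennreal (\<Sum>j\<in>{1..d}. f x j) * indicator A x \<partial>?R)"
  proof (rule nn_integral_cong)
    fix x assume "x \<in> space ?R"
    then have x: "0 \<le> x" by (simp add: space_restrict_space)
    have "(\<integral>\<^sup>+ j. ?F (x, j) * indicator B (x, j) \<partial>?N) = (\<Sum>j\<in>{1..d}. ennreal (f x j) * indicator A x)"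
      using x by (simp add: nn_integral_count_space_finite B_def space_pair_measure
          space_restrict_space indicator_def)
    \<comment> \<open>Nonnegativity enters here: \<open>ennreal\<close> sends negative numbers to 0,
      so it is additive on nonnegative terms but not in general.\<close>
    also have "\<dots> = ennreal (\<Sum>j\<in>{1..d}. f x j) * indicator A x"
      using nonneg[OF x] by (simp only: sum_distrib_right[symmetric] sum_ennreal)
    finally show "(\<integral>\<^sup>+ j. ?F (x, j) * indicator B (x, j) \<partial>?N)
      = ennreal (\<Sum>j\<in>{1..d}. f x j) * indicator A x" .
  qed
  also have "\<dots> = (\<integral>\<^sup>+ x\<in>{0..} \<inter> A. ennreal (\<Sum>j\<in>{1..d}. f x j) \<partial>lborel)"
    by (subst nn_integral_restrict_space)
       (auto intro!: nn_integral_cong simp: indicator_def)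
  finally show ?thesis .
qed

section \<open>Analysis on the half-line, including its closed endpoint\<close>

lemma FP_regular_continuous_on:
  assumes "FP_regular u" "0 < t"
  shows "continuous_on {0..} (\<lambda>x. u x t)"
  unfolding continuous_on_eq_continuous_within
proof
  fix x :: real assume "x \<in> {0..}"
  show "continuous (at x within {0..}) (\<lambda>x. u x t)"
  proof (cases "x = 0")
    case True
    then show ?thesis
      using assms by (auto simp: FP_regular_def intro: field_differentiable_imp_continuous_at)
  next
    case False
    with \<open>x \<in> {0..}\<close> have "(\<lambda>y. u y t) field_differentiable at x"
      using assms by (auto simp: FP_regular_def)
    then show ?thesis
      using continuous_at_imp_continuous_at_within field_differentiable_imp_continuous_at by blast
  qed
qed

lemma FP_regular_has_derivs:
  assumes "FP_regular u" "0 < t" "0 < x"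
  shows "((\<lambda>s. u x s) has_field_derivative deriv (\<lambda>s. u x s) t) (at t)"
    and "((\<lambda>y. u y t) has_field_derivative deriv (\<lambda>y. u y t) x) (at x)"
    and "(deriv (\<lambda>y. u y t) has_field_derivative deriv (deriv (\<lambda>y. u y t)) x) (at x)"
  using assms by (auto simp: FP_regular_def field_differentiable_derivI)

text \<open>The filter lies above \<open>at_right x\<close>, which is nontrivial. Nontriviality
  makes derivatives within \<open>{a..}\<close> unique, so that \<open>vector_derivative\<close>,
  defined by choice, can be evaluated at interior points and at the endpoint alike.\<close>

lemma at_within_Ici_neq_bot:
  fixes a x :: real
  assumes "a \<le> x"
  shows "at x within {a..} \<noteq> bot"
proof -
  have "at_right x \<le> at x within {a..}"
    using assms by (intro at_le) auto
  then show ?thesis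
    using trivial_limit_at_right_real[of x] by (metis bot.extremum_uniqueI)
qed

lemma boundary_deriv_eqI:
  assumes "(g has_field_derivative D) (at 0 within {0..})"
  shows "boundary_deriv g = D"
proof -
  have "(g has_vector_derivative D) (at 0 within {0..})"
    using assms by (simp add: has_real_derivative_iff_has_vector_derivative)
  then show ?thesis
    unfolding boundary_deriv_def by (rule vector_derivative_within[OF at_within_Ici_neq_bot, OF order.refl])
qed

lemma FP_regular_boundary_deriv:
  assumes "FP_regular u" "0 < t"
  shows "((\<lambda>x. u x t) has_field_derivative boundary_deriv (\<lambda>x. u x t)) (at 0 within {0..})"
proof -
  from assms obtain D where D: "((\<lambda>x. u x t) has_field_derivative D) (at 0 within {0..})"
    unfolding FP_regular_def field_differentiable_def by blast
  with boundary_deriv_eqI[OF D] show ?thesis by simp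
qed

text \<open>Differentiation commutes with finite sums. The care goes into the domain:
  \<open>u\<close> is the sum only for x \<ge> 0 and t > 0, so each derivative is transferred on a
  neighbourhood inside that region, which is one-sided at x = 0.\<close>

lemma has_derivs_of_eq_sum:
  fixes f :: "real \<Rightarrow> nat \<Rightarrow> real \<Rightarrow> real"
  assumes "\<forall>j\<in>I. FP_regular (\<lambda>x t. f x j t)"
    and "\<forall>x\<ge>0. \<forall>t>0. u x t = (\<Sum>j\<in>I. f x j t)"
    and "0 < t"
  shows "0 < x \<Longrightarrow> ((\<lambda>s. u x s) has_field_derivative (\<Sum>j\<in>I. deriv (\<lambda>s. f x j s) t)) (at t)"
    and "0 < x \<Longrightarrow> ((\<lambda>y. u y t) has_field_derivative (\<Sum>j\<in>I. deriv (\<lambda>y. f y j t) x)) (at x)"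
    and "0 < x \<Longrightarrow>
      (deriv (\<lambda>y. u y t) has_field_derivative (\<Sum>j\<in>I. deriv (deriv (\<lambda>y. f y j t)) x)) (at x)"
    and "((\<lambda>y. u y t) has_field_derivative (\<Sum>j\<in>I. boundary_deriv (\<lambda>y. f y j t))) (at 0 within {0..})"
proof -
  note reg = bspec[OF assms(1)] and eq = assms(2)[rule_format]
  show "((\<lambda>s. u x s) has_field_derivative (\<Sum>j\<in>I. deriv (\<lambda>s. f x j s) t)) (at t)" if "0 < x"
  proof (rule has_field_derivative_transform_within_open[where S = "{0<..}"])
    show "((\<lambda>s. \<Sum>j\<in>I. f x j s) has_field_derivative (\<Sum>j\<in>I. deriv (\<lambda>s. f x j s) t)) (at t)"
      by (rule DERIV_sum) (use FP_regular_has_derivs(1)[OF reg \<open>0 < t\<close> that] in simp)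
  qed (use that \<open>0 < t\<close> eq in auto)
  \<comment> \<open>Proved for every positive \<open>x\<close>: the second derivative needs the
    formula for \<open>deriv\<close> on a whole neighbourhood of the point.\<close>
  show first: "((\<lambda>y. u y t) has_field_derivative (\<Sum>j\<in>I. deriv (\<lambda>y. f y j t) x)) (at x)"
    if "0 < x" for x
  proof (rule has_field_derivative_transform_within_open[where S = "{0<..}"])
    show "((\<lambda>y. \<Sum>j\<in>I. f y j t) has_field_derivative (\<Sum>j\<in>I. deriv (\<lambda>y. f y j t) x)) (at x)"
      by (rule DERIV_sum) (use FP_regular_has_derivs(2)[OF reg \<open>0 < t\<close> that] in simp)
  qed (use that \<open>0 < t\<close> eq in auto)
  show "(deriv (\<lambda>y. u y t) has_field_derivative (\<Sum>j\<in>I. deriv (deriv (\<lambda>y. f y j t)) x)) (at x)"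
    if "0 < x"
  proof (rule has_field_derivative_transform_within_open[where S = "{0<..}"])
    show "((\<lambda>y. \<Sum>j\<in>I. deriv (\<lambda>y. f y j t) y)
        has_field_derivative (\<Sum>j\<in>I. deriv (deriv (\<lambda>y. f y j t)) x)) (at x)"
      by (rule DERIV_sum) (use FP_regular_has_derivs(3)[OF reg \<open>0 < t\<close> that] in simp)
  qed (use that DERIV_imp_deriv[OF first] in auto)
  have "((\<lambda>y. \<Sum>j\<in>I. f y j t) has_field_derivative (\<Sum>j\<in>I. boundary_deriv (\<lambda>y. f y j t)))
      (at 0 within {0..})"
    by (rule DERIV_sum) (use FP_regular_boundary_deriv[OF reg \<open>0 < t\<close>] in simp)
  then show "((\<lambda>y. u y t) has_field_derivative (\<Sum>j\<in>I. boundary_deriv (\<lambda>y. f y j t)))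
      (at 0 within {0..})"
    \<comment> \<open>Any positive radius would do, as the two functions agree on all of
      \<open>{0..}\<close>.\<close>
    by (rule has_field_derivative_transform_within[where d = 1]) (use eq \<open>0 < t\<close> in auto)
qed

text \<open>The fundamental theorem of calculus applies on the compact interval
  \<open>{0..x + 1}\<close>. Ending it beyond \<open>x\<close> makes it coincide with
  \<open>{0..}\<close> near \<open>x\<close>, so the derivative within either set is the
  same.\<close>

lemma integral_has_real_derivative_Ici:
  fixes g :: "real \<Rightarrow> real"
  assumes "continuous_on {0..} g" "0 \<le> x"
  shows "((\<lambda>y. integral {0..y} g) has_real_derivative g x) (at x within {0..})"
proof -
  have "((\<lambda>y. integral {0..y} g) has_vector_derivative g x) (at x within {0..x + 1})"
    using assms by (intro integral_has_vector_derivative continuous_on_subset[OF assms(1)]) auto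
  moreover have "at x within {0..x + 1} = at x within {0..}"
    by (rule at_within_nhd[where S = "{x - 1<..<x + 1}"]) (use assms in auto)
  ultimately show ?thesis
    by (simp add: has_real_derivative_iff_has_vector_derivative)
qed

text \<open>If \<open>B\<close> bounds \<phi> in absolute value, the product is dominated by
  \<open>B\<close> times the integrable function \<open>g\<close>.\<close>

lemma set_integrable_bounded_mult:
  fixes \<phi> g :: "real \<Rightarrow> real"
  assumes "continuous_on {0..} \<phi>" "bounded (\<phi> ` {0..})" "set_integrable lborel {0..} g"
  shows "set_integrable lborel {0..} (\<lambda>x. \<phi> x * g x)"
proof -
  from assms(2) obtain B where B: "\<And>x. 0 \<le> x \<Longrightarrow> \<bar>\<phi> x\<bar> \<le> B"
    by (auto simp: bounded_iff)
  have [measurable]: "(\<lambda>x. indicator {0..} x *\<^sub>R \<phi> x) \<in> borel_measurable borel"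
    using borel_measurable_continuous_on_indicator[OF _ assms(1)] by simp
  have g: "integrable lborel (\<lambda>x. indicator {0..} x *\<^sub>R g x)"
    using assms(3) by (simp add: set_integrable_def)
  \<comment> \<open>Both factors carry the indicator because nothing is known of them off the
    half-line, not even measurability. The square of an indicator is the indicator itself.\<close>
  have "integrable lborel (\<lambda>x. (indicator {0..} x *\<^sub>R \<phi> x) * (indicator {0..} x *\<^sub>R g x))"
  proof (rule Bochner_Integration.integrable_bound[OF integrable_mult_right[OF g, of B]])
    show "AE x in lborel. norm ((indicator {0..} x *\<^sub>R \<phi> x) * (indicator {0..} x *\<^sub>R g x))
      \<le> norm (B * (indicator {0..} x *\<^sub>R g x))"
    proof (intro AE_I2)
      fix x :: real
      show "norm ((indicator {0..} x *\<^sub>R \<phi> x) * (indicator {0..} x *\<^sub>R g x))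
        \<le> norm (B * (indicator {0..} x *\<^sub>R g x))"
        using B[of x] by (auto simp: abs_mult indicator_def intro!: mult_right_mono)
    qed
  qed (use g in measurable)
  moreover have "(\<lambda>x. (indicator {0..} x *\<^sub>R \<phi> x) * (indicator {0..} x *\<^sub>R g x))
      = (\<lambda>x. indicator {0::real..} x *\<^sub>R (\<phi> x * g x))"
    by (auto simp: indicator_def)
  ultimately show ?thesis by (simp add: set_integrable_def)
qed

theorem proposition5p2:
  fixes M :: "'a measure"
    and Z :: "real \<Rightarrow> 'a \<Rightarrow> real" and J :: "real \<Rightarrow> 'a \<Rightarrow> nat"
    and f :: "real \<Rightarrow> nat \<Rightarrow> real \<Rightarrow> real"
    and C :: "nat \<Rightarrow> nat \<Rightarrow> real"
    and d l0 :: nat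
    and \<alpha> \<beta> \<gamma> \<nu> \<xi> \<sigma> :: real
  defines "h \<equiv> transition_density M Z"
  assumes d: "0 < d" and l0: "l0 \<in> {1..d}"
    and pos: "0 < \<alpha>" "0 < \<gamma>" "0 < \<nu>" "0 < \<xi>"
    and sigma: "\<sigma>\<^sup>2 = \<alpha> * \<nu>" and beta: "\<beta> = \<gamma> * \<nu> / \<alpha>"
    and C: "stochastic_matrix d C" "irreducible_matrix d C"
    and M: "prob_space M"
    and process: "\<And>t. 0 \<le> t \<Longrightarrow> (\<lambda>\<omega>. (Z t \<omega>, J t \<omega>)) \<in> measurable M (star_measure d)"
    and start: "AE \<omega> in M. Z 0 \<omega> = 0 \<and> J 0 \<omega> = l0"
    and f_nonneg: "\<And>x j t. 0 \<le> x \<Longrightarrow> j \<in> {1..d} \<Longrightarrow> 0 < t \<Longrightarrow> 0 \<le> f x j t"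
    and f_density: "\<And>t. 0 < t \<Longrightarrow>
          distributed M (star_measure d) (\<lambda>\<omega>. (Z t \<omega>, J t \<omega>)) (\<lambda>(x, j). ennreal (f x j t))"
    and f_regular: "\<And>j. j \<in> {1..d} \<Longrightarrow> FP_regular (\<lambda>x t. f x j t)"
    and f_pde: "\<And>x j t. 0 < x \<Longrightarrow> j \<in> {1..d} \<Longrightarrow> 0 < t \<Longrightarrow>
          deriv (\<lambda>s. f x j s) t
            = - deriv (\<lambda>y. - \<alpha> * (y - \<beta>) * f y j t) x
              + 1 / 2 * \<sigma>\<^sup>2 * deriv (deriv (\<lambda>y. f y j t)) x
              - \<xi> * f x j t"
    and f_initial: "star_dirac_initial d l0 f"
    and f_flux: "\<And>t. 0 < t \<Longrightarrow>
          (\<Sum>l\<in>{1..d}. \<alpha> * \<beta> * f 0 l t - \<sigma>\<^sup>2 / 2 * boundary_deriv (\<lambda>x. f x l t)) - \<xi> = 0"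
    and f_switch: "\<And>j t. j \<in> {1..d} \<Longrightarrow> 0 < t \<Longrightarrow>
          f 0 j t = (\<Sum>l\<in>{1..d}. C l j * f 0 l t)"
    and f_infinity: "\<And>j t. j \<in> {1..d} \<Longrightarrow> 0 < t \<Longrightarrow> ((\<lambda>x. f x j t) \<longlongrightarrow> 0) at_top"
  shows "(\<forall>t>0. \<forall>x\<ge>0.
            ((\<lambda>y. \<P>(\<omega> in M. Z t \<omega> \<le> y \<bar> Z 0 \<omega> = 0)) has_real_derivative h x t) (at x within {0..})
            \<and> h x t = (\<Sum>j\<in>{1..d}. f x j t))
       \<and> FP_regular h
       \<and> (\<forall>t>0. \<forall>x>0.
            deriv (\<lambda>s. h x s) t
              = - \<xi> * h x t
                - deriv (\<lambda>y. - \<alpha> * (y - \<beta>) * h y t) x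
                + 1 / 2 * \<sigma>\<^sup>2 * deriv (deriv (\<lambda>y. h y t)) x)
       \<and> (\<forall>t>0. - \<xi> + \<alpha> * \<beta> * h 0 t - \<sigma>\<^sup>2 / 2 * boundary_deriv (\<lambda>x. h x t) = 0)
       \<and> (\<forall>t>0. ((\<lambda>x. h x t) \<longlongrightarrow> 0) at_top)
       \<and> dirac_initial h"
proof -
  interpret prob_space M by (rule M)
  \<comment> \<open>The candidate density. As \<open>h\<close> is defined by differentiating a
    distribution function, the analysis is first done for this explicit sum.\<close>
  define g where "g = (\<lambda>x t. \<Sum>j\<in>{1..d}. f x j t)"

  \<comment> \<open>Continuity, sign and marginal law of the summed density\<close>
  have f_cont: "continuous_on {0..} (\<lambda>x. f x j t)" if "j \<in> {1..d}" "0 < t" for j t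
    using FP_regular_continuous_on[OF f_regular[OF that(1)] that(2)] .
  have g_cont: "continuous_on {0..} (\<lambda>x. g x t)" if "0 < t" for t
    unfolding g_def using f_cont that by (intro continuous_on_sum) auto
  have g_nonneg: "0 \<le> g x t" if "0 \<le> x" "0 < t" for x t
    unfolding g_def using f_nonneg that by (intro sum_nonneg) auto
  have Z_meas: "Z t \<in> borel_measurable M" if "0 \<le> t" for t
  proof -
    have "fst \<in> measurable (star_measure d) borel"
      unfolding star_measure_def
      by (rule measurable_compose[OF measurable_fst]) (simp add: measurable_restrict_space1)
    from measurable_compose[OF process[OF that] this] show ?thesis by simp
  qed
  have marginal: "emeasure M {\<omega> \<in> space M. Z t \<omega> \<in> A} = (\<integral>\<^sup>+ x\<in>{0..} \<inter> A. ennreal (g x t) \<partial>lborel)"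
    if "0 < t" "A \<in> sets borel" for t A
    unfolding g_def
    using marginal_of_star_density[OF f_density[OF that(1)] f_nonneg[OF _ _ that(1)] that(2)] .

  \<comment> \<open>The distribution function and its derivative\<close>
  have cdf: "\<P>(\<omega> in M. Z t \<omega> \<le> y \<bar> Z 0 \<omega> = 0) = integral {0..y} (\<lambda>x. g x t)"
    if t: "0 < t" and y: "0 \<le> y" for t y
  proof -
    have [measurable]: "Z t \<in> borel_measurable M" "Z 0 \<in> borel_measurable M"
      using Z_meas t by auto
    \<comment> \<open>A conditional probability is a quotient: \<open>start\<close> makes the
      denominator 1 and lets the condition be dropped from the numerator up to a null set.\<close>
    have "\<P>(\<omega> in M. Z 0 \<omega> = 0) = 1"
      by (subst prob_Collect_eq_1) (use start in auto)
    moreover have "\<P>(\<omega> in M. Z t \<omega> \<le> y \<and> Z 0 \<omega> = 0) = \<P>(\<omega> in M. Z t \<omega> \<le> y)"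
      by (rule finite_measure_eq_AE) (use start in auto)
    ultimately have "\<P>(\<omega> in M. Z t \<omega> \<le> y \<bar> Z 0 \<omega> = 0) = \<P>(\<omega> in M. Z t \<omega> \<le> y)"
      by (simp add: cond_prob_def)
    \<comment> \<open>The integral changes type twice: continuity on \<open>{0..y}\<close> turns the
      nonnegative integral into a Lebesgue integral, and that into the gauge integral for which the
      fundamental theorem was stated.\<close>
    moreover have "emeasure M {\<omega> \<in> space M. Z t \<omega> \<le> y} = ennreal (integral {0..y} (\<lambda>x. g x t))"
    proof -
      have c: "continuous_on {0..y} (\<lambda>x. g x t)"
        by (rule continuous_on_subset[OF g_cont[OF t]]) auto
      have "emeasure M {\<omega> \<in> space M. Z t \<omega> \<le> y} = (\<integral>\<^sup>+ x\<in>{0..y}. ennreal (g x t) \<partial>lborel)"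
        using marginal[OF t, of "{..y}"] by (simp add: atLeastAtMost_def)
      also have "\<dots> = (\<integral>\<^sup>+ x. ennreal (indicator {0..y} x *\<^sub>R g x t) \<partial>lborel)"
        by (intro nn_integral_cong) (auto simp: indicator_def)
      also have "\<dots> = ennreal (LINT x:{0..y}|lborel. g x t)"
        unfolding set_lebesgue_integral_def
        using borel_integrable_atLeastAtMost'[OF c] g_nonneg t
        by (intro nn_integral_eq_integral) (auto simp: set_integrable_def indicator_def)
      also have "(LINT x:{0..y}|lborel. g x t) = integral {0..y} (\<lambda>x. g x t)"
        by (rule set_borel_integral_eq_integral) (rule borel_integrable_atLeastAtMost'[OF c])
      finally show ?thesis .
    qed
    \<comment> \<open>Needed to remove \<open>ennreal\<close> from the previous equation.\<close>
    moreover have "0 \<le> integral {0..y} (\<lambda>x. g x t)"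
      by (rule Henstock_Kurzweil_Integration.integral_nonneg)
         (use g_nonneg t in \<open>auto intro!: integrable_continuous_real
            continuous_on_subset[OF g_cont[OF t]]\<close>)
    ultimately show ?thesis by (simp add: emeasure_eq_measure)
  qed

  have cdf_deriv: "((\<lambda>y. \<P>(\<omega> in M. Z t \<omega> \<le> y \<bar> Z 0 \<omega> = 0)) has_real_derivative g x t)
      (at x within {0..})" if "0 < t" "0 \<le> x" for t x
    by (rule has_field_derivative_transform_within[OF
          integral_has_real_derivative_Ici[OF g_cont[OF that(1)] that(2)], where d = 1])
       (use that cdf in auto)

  \<comment> \<open>Uniqueness of the derivative within \<open>{0..}\<close> identifies
    \<open>h\<close> with \<open>g\<close>, also at x = 0.\<close>
  have h_eq: "h x t = (\<Sum>j\<in>{1..d}. f x j t)" if "0 \<le> x" "0 < t" for x t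
    using vector_derivative_within[OF at_within_Ici_neq_bot[OF that(1)]] cdf_deriv[OF that(2,1)]
    by (simp add: h_def transition_density_def g_def has_real_derivative_iff_has_vector_derivative)

  \<comment> \<open>Regularity and the differential equation of \<open>h\<close>\<close>
  have "\<forall>j\<in>{1..d}. FP_regular (\<lambda>x t. f x j t)" "\<forall>x\<ge>0. \<forall>t>0. h x t = (\<Sum>j\<in>{1..d}. f x j t)"
    using f_regular h_eq by blast+
  note h_derivs = has_derivs_of_eq_sum[OF this]

  have h_regular: "FP_regular h"
    unfolding FP_regular_def field_differentiable_def using h_derivs by blast

  have h_pde: "deriv (\<lambda>s. h x s) t
      = - \<xi> * h x t - deriv (\<lambda>y. - \<alpha> * (y - \<beta>) * h y t) x + 1 / 2 * \<sigma>\<^sup>2 * deriv (deriv (\<lambda>y. h y t)) x"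
    if t: "0 < t" and x: "0 < x" for t x
  proof -
    \<comment> \<open>Stated for any regular \<open>u\<close>, as it serves both the density on each
      ray and \<open>h\<close>. With the product rule carried out, the equation is visibly linear in
      \<open>u\<close> and its derivatives.\<close>
    have drift: "deriv (\<lambda>y. - \<alpha> * (y - \<beta>) * u y t) x
        = - \<alpha> * u x t - \<alpha> * (x - \<beta>) * deriv (\<lambda>y. u y t) x" if "FP_regular u" for u
    proof (rule DERIV_imp_deriv)
      have "((\<lambda>y. - \<alpha> * (y - \<beta>)) has_field_derivative - \<alpha>) (at x)"
        by (auto intro!: derivative_eq_intros)
      from DERIV_mult[OF this FP_regular_has_derivs(2)[OF that t x]]
      show "((\<lambda>y. - \<alpha> * (y - \<beta>) * u y t) has_field_derivative
          - \<alpha> * u x t - \<alpha> * (x - \<beta>) * deriv (\<lambda>y. u y t) x) (at x)"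
        by (rule DERIV_cong) (simp add: algebra_simps)
    qed
    have "deriv (\<lambda>s. h x s) t = (\<Sum>j\<in>{1..d}. deriv (\<lambda>s. f x j s) t)"
      by (rule DERIV_imp_deriv) (rule h_derivs(1)[OF t x])
    also have "\<dots> = (\<Sum>j\<in>{1..d}. \<alpha> * f x j t + \<alpha> * (x - \<beta>) * deriv (\<lambda>y. f y j t) x
        + 1 / 2 * \<sigma>\<^sup>2 * deriv (deriv (\<lambda>y. f y j t)) x - \<xi> * f x j t)"
      by (intro sum.cong refl) (subst f_pde[OF x _ t], simp, subst drift[OF f_regular], simp_all)
    also have "\<dots> = \<alpha> * h x t + \<alpha> * (x - \<beta>) * deriv (\<lambda>y. h y t) x
        + 1 / 2 * \<sigma>\<^sup>2 * deriv (deriv (\<lambda>y. h y t)) x - \<xi> * h x t"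
      using x t
      by (simp add: h_eq DERIV_imp_deriv[OF h_derivs(2)] DERIV_imp_deriv[OF h_derivs(3)]
          sum.distrib sum_subtractf sum_distrib_left)
    finally show ?thesis
      by (subst drift[OF h_regular]) simp
  qed

  \<comment> \<open>Conditions at the vertex and at infinity\<close>
  have h_flux: "- \<xi> + \<alpha> * \<beta> * h 0 t - \<sigma>\<^sup>2 / 2 * boundary_deriv (\<lambda>x. h x t) = 0" if t: "0 < t" for t
    \<comment> \<open>The rate \<xi> stands outside the sum in \<open>f_flux\<close>, so it enters
      the condition for \<open>h\<close> once, not once per ray.\<close>
    using f_flux[OF t]
    by (simp add: h_eq t boundary_deriv_eqI[OF h_derivs(4)[OF t]] sum_subtractf sum_distrib_left)

  have h_infinity: "((\<lambda>x. h x t) \<longlongrightarrow> 0) at_top" if t: "0 < t" for t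
  proof -
    have "((\<lambda>x. \<Sum>j\<in>{1..d}. f x j t) \<longlongrightarrow> (\<Sum>j\<in>{1..d}. 0)) at_top"
      by (intro tendsto_sum f_infinity t)
    moreover have "\<forall>\<^sub>F x in at_top. (\<Sum>j\<in>{1..d}. f x j t) = h x t"
      using eventually_ge_at_top[of "0::real"] by eventually_elim (simp add: h_eq t)
    ultimately show ?thesis
      by (auto dest: Lim_transform_eventually)
  qed

  \<comment> \<open>Integrability and the Dirac initial condition\<close>
  have f_integrable: "set_integrable lborel {0..} (\<lambda>x. f x j t)"
    if j: "j \<in> {1..d}" and t: "0 < t" for j t
    unfolding set_integrable_def
  proof (rule integrableI_nonneg)
    show "(\<lambda>x. indicator {0..} x *\<^sub>R f x j t) \<in> borel_measurable lborel"
      using borel_measurable_continuous_on_indicator[OF _ f_cont[OF j t]] by simp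
    show "AE x in lborel. 0 \<le> indicator {0..} x *\<^sub>R f x j t"
      using f_nonneg j t by (auto simp: indicator_def)
    \<comment> \<open>Each ray density is at most the sum \<open>g\<close>, whose integral over the
      half-line is the total mass 1.\<close>
    have "(\<integral>\<^sup>+ x. ennreal (indicator {0..} x *\<^sub>R f x j t) \<partial>lborel)
        \<le> (\<integral>\<^sup>+ x\<in>{0..}. ennreal (g x t) \<partial>lborel)"
    proof (rule nn_integral_mono)
      fix x :: real
      have "f x j t \<le> g x t" if "0 \<le> x"
        unfolding g_def using f_nonneg that t j by (intro member_le_sum) auto
      then show "ennreal (indicator {0..} x *\<^sub>R f x j t) \<le> ennreal (g x t) * indicator {0..} x"
        by (auto simp: indicator_def ennreal_leI)
    qed
    also have "\<dots> = emeasure M (space M)"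
      using marginal[OF t, of UNIV] by simp
    finally show "(\<integral>\<^sup>+ x. ennreal (indicator {0..} x *\<^sub>R f x j t) \<partial>lborel) < \<infinity>"
      by (simp add: emeasure_space_1 order.strict_trans1)
  qed

  have h_initial: "dirac_initial h"
    unfolding dirac_initial_def
  proof (intro allI impI, elim conjE)
    fix \<phi> :: "real \<Rightarrow> real"
    assume \<phi>: "continuous_on {0..} \<phi>" "bounded (\<phi> ` {0..})"
    then have "star_test_function d (\<lambda>x j. \<phi> x)"
      by (simp add: star_test_function_def)
    then have "((\<lambda>t. \<Sum>j\<in>{1..d}. LINT x:{0..}|lborel. \<phi> x * f x j t)
        \<longlongrightarrow> (\<Sum>j\<in>{1..d}. \<phi> 0 * (if j = l0 then 1 else 0))) (at_right 0)"
      using f_initial unfolding star_dirac_initial_def by blast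
    \<comment> \<open>Since \<open>l0\<close> is one of the rays, exactly one term survives.\<close>
    moreover have "(\<Sum>j\<in>{1..d}. \<phi> 0 * (if j = l0 then 1 else 0)) = \<phi> 0"
      using l0 by (simp add: sum_distrib_left[symmetric])
    moreover have "(\<Sum>j\<in>{1..d}. LINT x:{0..}|lborel. \<phi> x * f x j t)
        = (LINT x:{0..}|lborel. \<phi> x * h x t)" if t: "0 < t" for t
    proof -
      have "(LINT x:{0..}|lborel. \<phi> x * h x t)
          = (LINT x:{0..}|lborel. (\<Sum>j\<in>{1..d}. \<phi> x * f x j t))"
        by (rule set_lebesgue_integral_cong) (auto simp: h_eq t sum_distrib_left)
      \<comment> \<open>The Lebesgue integral is additive here because every summand is integrable:
        a bounded continuous function times an integrable density.\<close>
      also have "\<dots> = (\<Sum>j\<in>{1..d}. LINT x:{0..}|lborel. \<phi> x * f x j t)"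
        using set_integrable_bounded_mult[OF \<phi> f_integrable[OF _ t]]
        unfolding set_lebesgue_integral_def set_integrable_def scaleR_sum_right
        by (intro Bochner_Integration.integral_sum) auto
      finally show ?thesis ..
    qed
    ultimately show "((\<lambda>t. LINT x:{0..}|lborel. \<phi> x * h x t) \<longlongrightarrow> \<phi> 0) (at_right 0)"
      \<comment> \<open>The integrals were identified only for t > 0, which suffices for the limit
        along \<open>at_right 0\<close>.\<close>
      by (auto elim!: Lim_transform_eventually intro!: eventually_at_right_less[THEN eventually_mono])
  qed

  show ?thesis
    using cdf_deriv h_eq h_regular h_pde h_flux h_infinity h_initial by (simp add: g_def)
qed

end
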